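(* Let $G$ be a topological group and let $p\colon E\to B$ be a $G$-fibration. For a $G$-invariant (not necessarily open) subset $U$ of $E\times_B E$ the following are equivalent: 1. there exists a $G$-equivariant section over $U$ of the map $\Pi\colon E^I_B\to E\times_B E$, $\Pi(\gamma)=(\gamma(0),\gamma(1))$; 2. there exists a $G$-homotopy between the inclusion map $i_U\colon U\hookrightarrow E\times_B E$ and a $G$-map $f\colon U\to E\times_B E$ which takes values in the diagonal $\Delta(E)$.
   Context: All spaces are Hausdorff, $I=[0,1]$, path spaces carry the compact-open topology. A $G$-map is a continuous equivariant map; a $G$-homotopy is an equivariant homotopy ($G$ acting trivially on $I$). A $G$-fibration is a $G$-map with the $G$-homotopy lifting property with respect to every $G$-space. For a $G$-fibration $p\colon E\to B$: $E^I_B$ is the space of paths $\gamma\colon I\to E$ whose image lies in a single fibre $p^{-1}(b)$, $b\in B$, with $(g\cdot\gamma)(t)=g\cdot\gamma(t)$; $E\times_B E=\{(e_1,e_2)\in E\times E : p(e_1)=p(e_2)\}$ with the diagonal $G$-action; $\Delta(E)=\{(e,e): e\in E\}\subseteq E\times_B E$. The map $\Pi$ is a $G$-fibration. A section of $\Pi$ over $U$ is a continuous map $\sigma\colon U\to E^I_B$ with $\Pi\circ\sigma=i_U$. *)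

theory Defs
  imports "HOL-Analysis.Analysis" "HOL-Algebra.Group_Action"
begin

section \<open>Spaces with a group action\<close>

definition topological_group :: "('g, 'm) monoid_scheme \<Rightarrow> 'g topology \<Rightarrow> bool" where
  "topological_group G T \<longleftrightarrow>
     group G \<and> topspace T = carrier G \<and> Hausdorff_space T \<and>
     continuous_map (prod_topology T T) T (\<lambda>(g, h). g \<otimes>\<^bsub>G\<^esub> h) \<and>
     continuous_map T T (\<lambda>g. inv\<^bsub>G\<^esub> g)"

definition G_space ::
  "('g, 'm) monoid_scheme \<Rightarrow> 'g topology \<Rightarrow> 'x topology \<Rightarrow> ('g \<Rightarrow> 'x \<Rightarrow> 'x) \<Rightarrow> bool" where
  "G_space G T X \<phi> \<longleftrightarrow>
     Hausdorff_space X \<and> group_action G (topspace X) \<phi> \<and>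
     continuous_map (prod_topology T X) X (\<lambda>(g, x). \<phi> g x)"

definition equivariant_on ::
  "('g, 'm) monoid_scheme \<Rightarrow> 'x set \<Rightarrow> ('g \<Rightarrow> 'x \<Rightarrow> 'x) \<Rightarrow> ('g \<Rightarrow> 'y \<Rightarrow> 'y) \<Rightarrow> ('x \<Rightarrow> 'y) \<Rightarrow> bool" where
  "equivariant_on G S \<phi> \<psi> f \<longleftrightarrow> (\<forall>g\<in>carrier G. \<forall>x\<in>S. f (\<phi> g x) = \<psi> g (f x))"

definition G_map ::
  "('g, 'm) monoid_scheme \<Rightarrow> 'x topology \<Rightarrow> ('g \<Rightarrow> 'x \<Rightarrow> 'x) \<Rightarrow>
   'y topology \<Rightarrow> ('g \<Rightarrow> 'y \<Rightarrow> 'y) \<Rightarrow> ('x \<Rightarrow> 'y) \<Rightarrow> bool" where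
  "G_map G X \<phi> Y \<psi> f \<longleftrightarrow> continuous_map X Y f \<and> equivariant_on G (topspace X) \<phi> \<psi> f"

text \<open>Since \<open>G\<close> acts trivially on the unit interval, a homotopy is equivariant iff each of
  its stages is. In \<^const>\<open>homotopic_with\<close> the interval is the first factor.\<close>

definition G_homotopic ::
  "('g, 'm) monoid_scheme \<Rightarrow> 'x topology \<Rightarrow> ('g \<Rightarrow> 'x \<Rightarrow> 'x) \<Rightarrow>
   'y topology \<Rightarrow> ('g \<Rightarrow> 'y \<Rightarrow> 'y) \<Rightarrow> ('x \<Rightarrow> 'y) \<Rightarrow> ('x \<Rightarrow> 'y) \<Rightarrow> bool" where
  "G_homotopic G X \<phi> Y \<psi> = homotopic_with (equivariant_on G (topspace X) \<phi> \<psi>) X Y"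

section \<open>Path spaces\<close>

text \<open>A map out of \<open>X\<close> is represented by the function that is \<^const>\<open>undefined\<close> off
  \<open>topspace X\<close>. Taking \<open>K = {}\<close> shows that every map belongs to the topological space.\<close>

definition compact_open_topology :: "'x topology \<Rightarrow> 'y topology \<Rightarrow> ('x \<Rightarrow> 'y) topology" where
  "compact_open_topology X Y = topology_generated_by
     {{f \<in> extensional (topspace X). continuous_map X Y f \<and> f ` K \<subseteq> V} |K V.
        compactin X K \<and> openin Y V}"

abbreviation unit_interval :: "real topology" where
  "unit_interval \<equiv> top_of_set {0..1}"

abbreviation path_space :: "'x topology \<Rightarrow> (real \<Rightarrow> 'x) topology" where
  "path_space X \<equiv> compact_open_topology unit_interval X"

definition path_action :: "('g \<Rightarrow> 'x \<Rightarrow> 'x) \<Rightarrow> 'g \<Rightarrow> (real \<Rightarrow> 'x) \<Rightarrow> (real \<Rightarrow> 'x)" where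
  "path_action \<phi> g \<gamma> = (\<lambda>t\<in>{0..1}. \<phi> g (\<gamma> t))"

definition fibre_path_space ::
  "'e topology \<Rightarrow> 'b topology \<Rightarrow> ('e \<Rightarrow> 'b) \<Rightarrow> (real \<Rightarrow> 'e) topology" where
  "fibre_path_space E B p =
     subtopology (path_space E) {\<gamma>. \<exists>b\<in>topspace B. \<forall>t\<in>{0..1}. p (\<gamma> t) = b}"

definition fibre_product :: "'e topology \<Rightarrow> ('e \<Rightarrow> 'b) \<Rightarrow> ('e \<times> 'e) topology" where
  "fibre_product E p = subtopology (prod_topology E E) {(e1, e2). p e1 = p e2}"

definition diagonal_action :: "('g \<Rightarrow> 'x \<Rightarrow> 'x) \<Rightarrow> 'g \<Rightarrow> 'x \<times> 'x \<Rightarrow> 'x \<times> 'x" where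
  "diagonal_action \<phi> g = map_prod (\<phi> g) (\<phi> g)"

definition path_ends :: "(real \<Rightarrow> 'x) \<Rightarrow> 'x \<times> 'x" where
  "path_ends \<gamma> = (\<gamma> 0, \<gamma> 1)"

section \<open>Equivariant fibrations\<close>

definition G_homotopy_lifting ::
  "('g, 'm) monoid_scheme \<Rightarrow> 'e topology \<Rightarrow> ('g \<Rightarrow> 'e \<Rightarrow> 'e) \<Rightarrow>
   'b topology \<Rightarrow> ('g \<Rightarrow> 'b \<Rightarrow> 'b) \<Rightarrow> ('e \<Rightarrow> 'b) \<Rightarrow> 'x topology \<Rightarrow> ('g \<Rightarrow> 'x \<Rightarrow> 'x) \<Rightarrow> bool" where
  "G_homotopy_lifting G E \<phi> B \<psi> p X \<theta> \<longleftrightarrow>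
     (\<forall>f H. G_map G X \<theta> E \<phi> f \<and>
        G_map G (prod_topology unit_interval X) (\<lambda>g. map_prod id (\<theta> g)) B \<psi> H \<and>
        (\<forall>x\<in>topspace X. H (0, x) = p (f x)) \<longrightarrow>
        (\<exists>K. G_map G (prod_topology unit_interval X) (\<lambda>g. map_prod id (\<theta> g)) E \<phi> K \<and>
          (\<forall>x\<in>topspace X. K (0, x) = f x) \<and>
          (\<forall>t\<in>{0..1}. \<forall>x\<in>topspace X. p (K (t, x)) = H (t, x))))"

text \<open>A definition cannot quantify over the types carrying the test spaces. The carrier type
  \<open>'e \<times> (real \<Rightarrow> 'b)\<close> is large enough to contain the mapping path space
  \<open>{(e, \<gamma>). \<gamma> 0 = p e}\<close>, the universal test space; hence lifting for the \<open>G\<close>-spaces on this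
  type entails lifting for all \<open>G\<close>-spaces on every type, which is
  \<open>G_fibration_lifting\<close> below.\<close>

definition G_fibration ::
  "('g, 'm) monoid_scheme \<Rightarrow> 'g topology \<Rightarrow> 'e topology \<Rightarrow> ('g \<Rightarrow> 'e \<Rightarrow> 'e) \<Rightarrow>
   'b topology \<Rightarrow> ('g \<Rightarrow> 'b \<Rightarrow> 'b) \<Rightarrow> ('e \<Rightarrow> 'b) \<Rightarrow> bool" where
  "G_fibration G T E \<phi> B \<psi> p \<longleftrightarrow>
     G_space G T E \<phi> \<and> G_space G T B \<psi> \<and> G_map G E \<phi> B \<psi> p \<and>
     (\<forall>(X :: ('e \<times> (real \<Rightarrow> 'b)) topology) \<theta>.
        G_space G T X \<theta> \<longrightarrow> G_homotopy_lifting G E \<phi> B \<psi> p X \<theta>)"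

subsection \<open>The compact-open topology\<close>

lemma topspace_compact_open_topology [simp]:
  "topspace (compact_open_topology X Y) = {f \<in> extensional (topspace X). continuous_map X Y f}"
proof -
  have "{f \<in> extensional (topspace X). continuous_map X Y f} \<in>
     {{f \<in> extensional (topspace X). continuous_map X Y f \<and> f ` K \<subseteq> V} |K V.
        compactin X K \<and> openin Y V}"
    by (rule CollectI, rule exI[of _ "{}"], rule exI[of _ "{}"]) auto
  then show ?thesis
    unfolding compact_open_topology_def topology_generated_by_topspace by blast
qed

lemma openin_compact_open_topology:
  assumes "compactin X K" "openin Y V"
  shows "openin (compact_open_topology X Y)
           {f \<in> extensional (topspace X). continuous_map X Y f \<and> f ` K \<subseteq> V}"
  unfolding compact_open_topology_def
  by (rule topology_generated_by_Basis) (use assms in blast)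

lemma Hausdorff_space_compact_open_topology:
  assumes "Hausdorff_space Y"
  shows "Hausdorff_space (compact_open_topology X Y)"
  unfolding Hausdorff_space_def
proof (intro allI impI, elim conjE)
  fix f g
  assume f: "f \<in> topspace (compact_open_topology X Y)"
    and g: "g \<in> topspace (compact_open_topology X Y)" and "f \<noteq> g"
  then obtain x where x: "x \<in> topspace X" "f x \<noteq> g x"
    by (metis (no_types, lifting) extensionalityI mem_Collect_eq topspace_compact_open_topology)
  moreover have "f x \<in> topspace Y" "g x \<in> topspace Y"
    using f g x by (auto simp: continuous_map_def Pi_iff)
  ultimately obtain U V where UV: "openin Y U" "openin Y V" "f x \<in> U" "g x \<in> V" "disjnt U V"
    using assms unfolding Hausdorff_space_def by metis
  let ?N = "\<lambda>U. {f \<in> extensional (topspace X). continuous_map X Y f \<and> f ` {x} \<subseteq> U}"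
  have "openin (compact_open_topology X Y) (?N U)" "openin (compact_open_topology X Y) (?N V)"
    using UV x by (intro openin_compact_open_topology; simp)+
  moreover have "f \<in> ?N U" "g \<in> ?N V"
    using f g UV by auto
  moreover have "disjnt (?N U) (?N V)"
    using UV by (auto simp: disjnt_iff)
  ultimately show "\<exists>U V. openin (compact_open_topology X Y) U \<and>
      openin (compact_open_topology X Y) V \<and> f \<in> U \<and> g \<in> V \<and> disjnt U V"
    by blast
qed

lemma continuous_map_compact_open_eval:
  assumes "neighbourhood_base_of (compactin X) X"
  shows "continuous_map (prod_topology (compact_open_topology X Y) X) Y (\<lambda>(f, x). f x)"
  unfolding continuous_map_def
proof (intro conjI allI impI)
  show "(\<lambda>(f, x). f x) \<in> topspace (prod_topology (compact_open_topology X Y) X) \<rightarrow> topspace Y"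
    by (auto simp: continuous_map_def Pi_iff)
next
  fix V assume V: "openin Y V"
  show "openin (prod_topology (compact_open_topology X Y) X)
     {z \<in> topspace (prod_topology (compact_open_topology X Y) X). (case z of (f, x) \<Rightarrow> f x) \<in> V}"
    unfolding openin_prod_topology_alt
  proof (intro allI impI)
    fix f x
    assume "(f, x) \<in> {z \<in> topspace (prod_topology (compact_open_topology X Y) X).
      (case z of (f, x) \<Rightarrow> f x) \<in> V}"
    then have f: "f \<in> extensional (topspace X)" "continuous_map X Y f"
      and x: "x \<in> topspace X" "f x \<in> V" by auto
    have "openin X {x \<in> topspace X. f x \<in> V}"
      using f V by (auto simp: continuous_map_def)
    with x obtain W K where W: "openin X W" "compactin X K" "x \<in> W" "W \<subseteq> K"
      "K \<subseteq> {x \<in> topspace X. f x \<in> V}"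
      using assms unfolding neighbourhood_base_of by (metis (mono_tags, lifting) mem_Collect_eq)
    let ?N = "{f \<in> extensional (topspace X). continuous_map X Y f \<and> f ` K \<subseteq> V}"
    have "openin (compact_open_topology X Y) ?N"
      using V W by (intro openin_compact_open_topology)
    moreover have "f \<in> ?N"
      using f W by auto
    moreover have "?N \<times> W \<subseteq> {z \<in> topspace (prod_topology (compact_open_topology X Y) X).
      (case z of (f, x) \<Rightarrow> f x) \<in> V}"
      using W by auto
    ultimately show "\<exists>U W. openin (compact_open_topology X Y) U \<and> openin X W \<and> f \<in> U \<and> x \<in> W \<and>
       U \<times> W \<subseteq> {z \<in> topspace (prod_topology (compact_open_topology X Y) X).
          (case z of (f, x) \<Rightarrow> f x) \<in> V}"
      using W by blast
  qed
qed

lemma continuous_map_compact_open_curry: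
  assumes h: "continuous_map (prod_topology X Z) Y h"
  shows "continuous_map Z (compact_open_topology X Y) (\<lambda>z. \<lambda>x\<in>topspace X. h (x, z))"
proof -
  have cont: "continuous_map X Y (\<lambda>x\<in>topspace X. h (x, z))" if "z \<in> topspace Z" for z
  proof -
    have "continuous_map X (prod_topology X Z) (\<lambda>x. (x, z))"
      using that by (intro continuous_map_pairedI) auto
    from continuous_map_compose[OF this h] show ?thesis
      by (rule continuous_map_eq) simp
  qed
  show ?thesis
    unfolding compact_open_topology_def
  proof (rule continuous_on_generated_topo)
    fix N assume "N \<in> {{f \<in> extensional (topspace X). continuous_map X Y f \<and> f ` K \<subseteq> V} |K V.
        compactin X K \<and> openin Y V}"
    then obtain K V where K: "compactin X K" and V: "openin Y V"
      and N: "N = {f \<in> extensional (topspace X). continuous_map X Y f \<and> f ` K \<subseteq> V}"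
      by blast
    have KX: "K \<subseteq> topspace X"
      using K compactin_subset_topspace by blast
    let ?W = "{w \<in> topspace (prod_topology X Z). h w \<in> V}"
    have W: "openin (prod_topology X Z) ?W"
      using h V by (auto simp: continuous_map_def)
    have eq: "(\<lambda>z. \<lambda>x\<in>topspace X. h (x, z)) -` N \<inter> topspace Z =
        {z \<in> topspace Z. \<forall>x\<in>K. h (x, z) \<in> V}"
      using cont KX by (auto simp: N image_subset_iff subset_iff)
    show "openin Z ((\<lambda>z. \<lambda>x\<in>topspace X. h (x, z)) -` N \<inter> topspace Z)"
      unfolding eq
    proof (subst openin_subopen, intro ballI)
      fix z assume "z \<in> {z \<in> topspace Z. \<forall>x\<in>K. h (x, z) \<in> V}"
      then have z: "z \<in> topspace Z" "K \<times> {z} \<subseteq> ?W"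
        using KX by auto
      obtain U M where UM: "openin X U" "openin Z M" "K \<subseteq> U" "z \<in> M" "U \<times> M \<subseteq> ?W"
        using tube_lemma_left[OF W K z] by blast
      then have "M \<subseteq> {z \<in> topspace Z. \<forall>x\<in>K. h (x, z) \<in> V}"
        using openin_subset[of Z M] by blast
      with UM show "\<exists>M. openin Z M \<and> z \<in> M \<and> M \<subseteq> {z \<in> topspace Z. \<forall>x\<in>K. h (x, z) \<in> V}"
        by blast
    qed
  next
    show "(\<lambda>z. \<lambda>x\<in>topspace X. h (x, z)) ` topspace Z \<subseteq>
      \<Union> {{f \<in> extensional (topspace X). continuous_map X Y f \<and> f ` K \<subseteq> V} |K V.
        compactin X K \<and> openin Y V}"
      unfolding topology_generated_by_topspace[symmetric] compact_open_topology_def[symmetric]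
      using cont by auto
  qed
qed

lemma continuous_map_path_space_eval:
  "continuous_map (prod_topology (path_space X) unit_interval) X (\<lambda>(\<gamma>, t). \<gamma> t)"
proof (rule continuous_map_compact_open_eval)
  have "Hausdorff_space unit_interval"
    by (simp add: Hausdorff_space_subtopology)
  moreover have "locally_compact_space unit_interval"
    by (rule compact_imp_locally_compact_space) (simp add: compact_space_subtopology)
  ultimately show "neighbourhood_base_of (compactin unit_interval) unit_interval"
    using locally_compact_space_neighbourhood_base by blast
qed

subsection \<open>Universality of the mapping path space\<close>

lemma group_action_restrictI:
  assumes G: "group G"
    and closed: "\<And>g x. g \<in> carrier G \<Longrightarrow> x \<in> S \<Longrightarrow> a g x \<in> S"
    and one: "\<And>x. x \<in> S \<Longrightarrow> a \<one>\<^bsub>G\<^esub> x = x"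
    and mult: "\<And>g h x. g \<in> carrier G \<Longrightarrow> h \<in> carrier G \<Longrightarrow> x \<in> S \<Longrightarrow> a (g \<otimes>\<^bsub>G\<^esub> h) x = a g (a h x)"
  shows "group_action G S (\<lambda>g. restrict (a g) S)"
proof -
  interpret group G by (rule G)
  have bij: "restrict (a g) S \<in> Bij S" if g: "g \<in> carrier G" for g
  proof -
    have "a g (a (inv\<^bsub>G\<^esub> g) x) = x" "a (inv\<^bsub>G\<^esub> g) (a g x) = x" if "x \<in> S" for x
      using mult[of g "inv\<^bsub>G\<^esub> g" x] mult[of "inv\<^bsub>G\<^esub> g" g x] g one that by auto
    then have "bij_betw (a g) S S"
      using closed g by (intro bij_betw_byWitness[where f' = "a (inv\<^bsub>G\<^esub> g)"]) auto
    then show ?thesis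
      by (simp add: Bij_def)
  qed
  have "group_hom G (BijGroup S) (\<lambda>g. restrict (a g) S)"
  proof (intro group_hom.intro group_hom_axioms.intro homI)
    fix g h assume gh: "g \<in> carrier G" "h \<in> carrier G"
    show "restrict (a (g \<otimes>\<^bsub>G\<^esub> h)) S = restrict (a g) S \<otimes>\<^bsub>BijGroup S\<^esub> restrict (a h) S"
      using gh closed by (auto simp: BijGroup_def bij compose_def mult fun_eq_iff)
  qed (use bij in \<open>auto simp: BijGroup_def[of S] G intro: group_BijGroup[unfolded BijGroup_def]\<close>)
  then show ?thesis
    by (rule group_action.intro)
qed

lemma G_fibration_lifting:
  fixes X :: "'x topology"
  assumes fib: "G_fibration G T E \<phi> B \<psi> p" and T: "topological_group G T"
    and X: "G_space G T X \<theta>"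
  shows "G_homotopy_lifting G E \<phi> B \<psi> p X \<theta>"
proof -
  have G: "group G" and TG: "topspace T = carrier G"
    using T by (auto simp: topological_group_def)
  interpret group G by (rule G)
  have E: "G_space G T E \<phi>" and B: "G_space G T B \<psi>" and p: "G_map G E \<phi> B \<psi> p"
    using fib by (auto simp: G_fibration_def)
  interpret aE: group_action G "topspace E" \<phi>
    using E by (simp add: G_space_def)
  interpret aB: group_action G "topspace B" \<psi>
    using B by (simp add: G_space_def)
  interpret aX: group_action G "topspace X" \<theta>
    using X by (simp add: G_space_def)
  have cE: "continuous_map (prod_topology T E) E (\<lambda>(g, x). \<phi> g x)"
    and cB: "continuous_map (prod_topology T B) B (\<lambda>(g, x). \<psi> g x)"
    using E B by (auto simp: G_space_def)
  define N where "N = subtopology (prod_topology E (path_space B)) {(e, \<gamma>). \<gamma> 0 = p e}"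
  define a where "a = (\<lambda>g (e, \<gamma>). (\<phi> g e, path_action \<psi> g \<gamma>))"
  define \<nu> where "\<nu> = (\<lambda>g. restrict (a g) (topspace N))"
  have N: "(e, \<gamma>) \<in> topspace N \<longleftrightarrow> e \<in> topspace E \<and> \<gamma> \<in> extensional {0..1} \<and>
      continuous_map unit_interval B \<gamma> \<and> \<gamma> 0 = p e" for e \<gamma>
    by (auto simp: N_def)
  have pB: "\<gamma> t \<in> topspace B" if "continuous_map unit_interval B \<gamma>" "t \<in> {0..1}" for \<gamma> t
    using that by (auto simp: continuous_map_def Pi_iff)
  have actB: "continuous_map unit_interval B (path_action \<psi> g \<gamma>)"
    if "g \<in> carrier G" "continuous_map unit_interval B \<gamma>" for g \<gamma>
  proof -
    have "continuous_map unit_interval (prod_topology T B) (\<lambda>t. (g, \<gamma> t))"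
      using that TG by (intro continuous_map_pairedI) auto
    from continuous_map_compose[OF this cB]
    have "continuous_map unit_interval B (\<lambda>t. \<psi> g (\<gamma> t))" by (simp add: o_def)
    then show ?thesis
      by (rule continuous_map_eq) (auto simp: path_action_def)
  qed
  have a_closed: "a g z \<in> topspace N" if "g \<in> carrier G" "z \<in> topspace N" for g z
  proof (cases z)
    case (Pair e \<gamma>)
    have "\<psi> g (p e) = p (\<phi> g e)" if "e \<in> topspace E"
      using p \<open>g \<in> carrier G\<close> that by (auto simp: G_map_def equivariant_on_def)
    then show ?thesis
      using that Pair actB[of g \<gamma>] aE.element_image[of g e]
      by (auto simp: a_def N) (auto simp: path_action_def)
  qed
  have G_N: "G_space G T N \<nu>"
    unfolding G_space_def
  proof (intro conjI)
    show "Hausdorff_space N"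
      using E B unfolding N_def G_space_def
      by (intro Hausdorff_space_subtopology)
         (simp add: Hausdorff_space_prod_topology Hausdorff_space_compact_open_topology)
    show "group_action G (topspace N) \<nu>"
      unfolding \<nu>_def
    proof (rule group_action_restrictI[OF G a_closed])
      fix z assume "z \<in> topspace N"
      then show "a \<one>\<^bsub>G\<^esub> z = z"
        by (cases z) (auto simp: a_def N path_action_def pB fun_eq_iff extensional_def
            aE.id_eq_one[symmetric] aB.id_eq_one[symmetric])
    next
      fix g h z assume "g \<in> carrier G" "h \<in> carrier G" "z \<in> topspace N"
      then show "a (g \<otimes>\<^bsub>G\<^esub> h) z = a g (a h z)"
        by (cases z) (auto simp: a_def N path_action_def pB fun_eq_iff
            aE.composition_rule aB.composition_rule)
    qed
    have c1: "continuous_map (prod_topology T N) E (\<lambda>(g, e, \<gamma>). \<phi> g e)"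
    proof -
      have "continuous_map (prod_topology T N) (prod_topology T E) (\<lambda>z. (fst z, fst (snd z)))"
        unfolding N_def
        by (intro continuous_map_pairedI continuous_map_fst continuous_map_fst_of[unfolded o_def]
            continuous_map_compose[OF continuous_map_snd, unfolded o_def]
            continuous_map_from_subtopology)
      from continuous_map_compose[OF this cE] show ?thesis
        by (simp add: o_def case_prod_unfold)
    qed
    have c2: "continuous_map (prod_topology T N) (path_space B) (\<lambda>(g, e, \<gamma>). path_action \<psi> g \<gamma>)"
    proof -
      let ?P = "prod_topology unit_interval (prod_topology T N)"
      have "continuous_map N (path_space B) snd"
        unfolding N_def by (intro continuous_map_from_subtopology continuous_map_snd)
      then have "continuous_map ?P (path_space B) (snd \<circ> (snd \<circ> snd))"
        by (rule continuous_map_compose[OF continuous_map_compose[OF continuous_map_snd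
              continuous_map_snd]])
      then have "continuous_map ?P (path_space B) (\<lambda>z. snd (snd (snd z)))"
        by (simp add: o_def)
      then have "continuous_map ?P (prod_topology (path_space B) unit_interval)
          (\<lambda>z. (snd (snd (snd z)), fst z))"
        by (intro continuous_map_pairedI continuous_map_fst)
      from continuous_map_compose[OF this continuous_map_path_space_eval]
      have "continuous_map ?P B (\<lambda>z. snd (snd (snd z)) (fst z))"
        by (simp add: o_def)
      then have "continuous_map ?P (prod_topology T B)
          (\<lambda>z. (fst (snd z), snd (snd (snd z)) (fst z)))"
        by (intro continuous_map_pairedI
            continuous_map_compose[OF continuous_map_snd continuous_map_fst, unfolded o_def])
      from continuous_map_compose[OF this cB]
      have "continuous_map ?P B (\<lambda>z. \<psi> (fst (snd z)) (snd (snd (snd z)) (fst z)))"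
        by (simp add: o_def)
      from continuous_map_compact_open_curry[OF this] show ?thesis
        by (simp add: path_action_def case_prod_unfold)
    qed
    have c: "continuous_map (prod_topology T N) N (\<lambda>z. a (fst z) (snd z))"
    proof -
      have "continuous_map (prod_topology T N) (prod_topology E (path_space B))
          (\<lambda>z. a (fst z) (snd z))"
        using continuous_map_pairedI[OF c1 c2] by (simp add: a_def case_prod_unfold)
      moreover have "a (fst z) (snd z) \<in> topspace N" if "z \<in> topspace (prod_topology T N)" for z
        using that a_closed TG by auto
      ultimately show "continuous_map (prod_topology T N) N (\<lambda>z. a (fst z) (snd z))"
        unfolding N_def by (auto simp: continuous_map_in_subtopology)
    qed
    then show "continuous_map (prod_topology T N) N (\<lambda>(g, x). \<nu> g x)"
      by (rule continuous_map_eq) (auto simp: \<nu>_def)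
  qed
  have pr1: "G_map G N \<nu> E \<phi> fst"
    unfolding G_map_def equivariant_on_def
    by (auto simp: N_def \<nu>_def a_def continuous_map_from_subtopology continuous_map_fst)
  have ev: "G_map G (prod_topology unit_interval N) (\<lambda>g. map_prod id (\<nu> g)) B \<psi> (\<lambda>(t, e, \<gamma>). \<gamma> t)"
    unfolding G_map_def
  proof
    have "continuous_map N (path_space B) snd"
      unfolding N_def by (intro continuous_map_from_subtopology continuous_map_snd)
    then have "continuous_map (prod_topology unit_interval N)
        (prod_topology (path_space B) unit_interval) (\<lambda>z. (snd (snd z), fst z))"
      by (intro continuous_map_pairedI continuous_map_fst
          continuous_map_compose[OF continuous_map_snd, unfolded o_def])
    from continuous_map_compose[OF this continuous_map_path_space_eval]
    show "continuous_map (prod_topology unit_interval N) B (\<lambda>(t, e, \<gamma>). \<gamma> t)"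
      by (simp add: o_def case_prod_unfold)
    show "equivariant_on G (topspace (prod_topology unit_interval N))
        (\<lambda>g. map_prod id (\<nu> g)) \<psi> (\<lambda>(t, e, \<gamma>). \<gamma> t)"
      unfolding equivariant_on_def by (auto simp: \<nu>_def a_def path_action_def)
  qed
  have "G_homotopy_lifting G E \<phi> B \<psi> p N \<nu>"
    using fib G_N by (auto simp: G_fibration_def)
  moreover have "\<forall>x\<in>topspace N. (\<lambda>(t, e, \<gamma>). \<gamma> t) (0, x) = p (fst x)"
    by (auto simp: N)
  ultimately obtain L where L: "G_map G (prod_topology unit_interval N) (\<lambda>g. map_prod id (\<nu> g)) E \<phi> L"
    and L0: "\<And>x. x \<in> topspace N \<Longrightarrow> L (0, x) = fst x"
    and pL: "\<And>t e \<gamma>. t \<in> {0..1} \<Longrightarrow> (e, \<gamma>) \<in> topspace N \<Longrightarrow> p (L (t, e, \<gamma>)) = \<gamma> t"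
    unfolding G_homotopy_lifting_def using pr1 ev by (smt (verit) case_prod_conv)
  show ?thesis
    unfolding G_homotopy_lifting_def
  proof (intro allI impI, elim conjE)
    fix f H
    assume f: "G_map G X \<theta> E \<phi> f"
      and H: "G_map G (prod_topology unit_interval X) (\<lambda>g. map_prod id (\<theta> g)) B \<psi> H"
      and H0: "\<forall>x\<in>topspace X. H (0, x) = p (f x)"
    define k where "k = (\<lambda>x. (f x, \<lambda>t\<in>{0..1}. H (t, x)))"
    have "continuous_map X (path_space B) (\<lambda>x. \<lambda>t\<in>{0..1}. H (t, x))"
      using continuous_map_compact_open_curry[of unit_interval X B H] H by (simp add: G_map_def)
    then have "continuous_map X (prod_topology E (path_space B)) k"
      unfolding k_def using f by (intro continuous_map_pairedI) (auto simp: G_map_def)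
    then have k: "continuous_map X N k"
      unfolding N_def using H0 by (auto simp: continuous_map_in_subtopology k_def)
    have kN: "k x \<in> topspace N" if "x \<in> topspace X" for x
      using k that by (auto simp: continuous_map_def)
    have k_eq: "k (\<theta> g x) = \<nu> g (k x)" if "g \<in> carrier G" "x \<in> topspace X" for g x
      using that kN[of x] f H
      by (auto simp: k_def \<nu>_def a_def path_action_def G_map_def equivariant_on_def fun_eq_iff)
    define K where "K = (\<lambda>(t, x). L (t, k x))"
    have "continuous_map (prod_topology unit_interval X) (prod_topology unit_interval N)
        (\<lambda>z. (fst z, k (snd z)))"
      by (intro continuous_map_pairedI continuous_map_fst
          continuous_map_compose[OF continuous_map_snd, unfolded o_def] k)
    from continuous_map_compose[OF this, of E L] L
    have "continuous_map (prod_topology unit_interval X) E K"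
      by (simp add: G_map_def K_def o_def case_prod_unfold)
    moreover have "equivariant_on G (topspace (prod_topology unit_interval X))
        (\<lambda>g. map_prod id (\<theta> g)) \<phi> K"
      using L kN by (auto simp: G_map_def equivariant_on_def K_def k_eq)
    ultimately show "\<exists>K. G_map G (prod_topology unit_interval X) (\<lambda>g. map_prod id (\<theta> g)) E \<phi> K \<and>
          (\<forall>x\<in>topspace X. K (0, x) = f x) \<and>
          (\<forall>t\<in>{0..1}. \<forall>x\<in>topspace X. p (K (t, x)) = H (t, x))"
      using kN by (intro exI[of _ K]) (auto simp: G_map_def K_def L0 k_def pL)
  qed
qed

end

theory Submission
  imports Defs
begin

text \<open>
  A section \<open>\<sigma>\<close> of the end point map is, by currying, a motion \<open>F (t, u) = \<sigma> u t\<close> that leads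
  from \<open>fst u\<close> to \<open>snd u\<close> inside one fibre.

  Such a motion yields a homotopy to the diagonal by running the second end point back to the
  first, \<open>(t, u) \<mapsto> (F (0, u), F (1 - t, u))\<close>, whose stages stay in the fibre product because the motion
  stays in a fibre.

  Conversely, let \<open>H = (a, b)\<close> be a homotopy from the inclusion to a map into the diagonal.
  Following \<open>a\<close> forwards and then \<open>b\<close> backwards gives a path \<open>\<alpha> u\<close> in the total space from
  \<open>fst u\<close> to \<open>snd u\<close>. It does not stay in one fibre, but because \<open>p \<circ> a = p \<circ> b\<close>, its image in the
  base runs along a path \<open>\<beta>\<close> and returns the same way. Such a loop is contracted by retracing
  shorter and shorter initial pieces of \<open>\<beta>\<close>, and this contraction fixes the base point. Lift it,
  with initial stage \<open>\<alpha>\<close>, to a family \<open>K\<close> of squares in the total space. The three sides of each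
  square other than \<open>\<alpha> u\<close> lie over the base point \<open>\<beta> 0\<close>, hence in one fibre, and together they form
  a path with the same end points as \<open>\<alpha> u\<close>. Going around these sides makes up for the fact that
  the lift is prescribed on one side of the square only and may move the end points of \<open>\<alpha> u\<close>.
  The test space for the lifting is the product of the interval with the given invariant set. The
  group acts trivially on all parameters in the interval, so that reparametrizing and
  concatenating paths preserves equivariance.
\<close>

section \<open>Test spaces\<close>

text \<open>A \<open>group_action\<close> acts by functions that are extensional on the carrier, so an action given
  by a formula becomes one only after restriction.\<close>

lemma G_space_restrictI:
  assumes T: "topological_group G T" and "Hausdorff_space X"
    and closed: "\<And>g x. g \<in> carrier G \<Longrightarrow> x \<in> topspace X \<Longrightarrow> a g x \<in> topspace X"
    and "\<And>x. x \<in> topspace X \<Longrightarrow> a \<one>\<^bsub>G\<^esub> x = x"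
    and "\<And>g h x. g \<in> carrier G \<Longrightarrow> h \<in> carrier G \<Longrightarrow> x \<in> topspace X \<Longrightarrow>
           a (g \<otimes>\<^bsub>G\<^esub> h) x = a g (a h x)"
    and cont: "continuous_map (prod_topology T X) X (\<lambda>(g, x). a g x)"
  shows "G_space G T X (\<lambda>g. restrict (a g) (topspace X))"
  unfolding G_space_def
proof (intro conjI)
  show "group_action G (topspace X) (\<lambda>g. restrict (a g) (topspace X))"
    using T by (intro group_action_restrictI assms) (auto simp: topological_group_def)
  show "continuous_map (prod_topology T X) X (\<lambda>(g, x). restrict (a g) (topspace X) x)"
    using cont by (rule continuous_map_eq) auto
qed fact

lemma continuous_map_fibre_product_iff:
  "continuous_map X (fibre_product E p) h \<longleftrightarrow>
     continuous_map X E (\<lambda>x. fst (h x)) \<and> continuous_map X E (\<lambda>x. snd (h x)) \<and>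
     (\<forall>x\<in>topspace X. p (fst (h x)) = p (snd (h x)))"
  by (auto simp: fibre_product_def continuous_map_in_subtopology continuous_map_pairwise o_def
      case_prod_unfold)

lemma G_space_interval_times_invariant_set:
  assumes T: "topological_group G T" and E: "G_space G T E \<phi>"
    and U: "U \<subseteq> topspace (fibre_product E p)"
    and inv: "\<forall>g\<in>carrier G. \<forall>u\<in>U. diagonal_action \<phi> g u \<in> U"
  defines "X \<equiv> prod_topology unit_interval (subtopology (fibre_product E p) U)"
  shows "G_space G T X (\<lambda>g. restrict (map_prod id (diagonal_action \<phi> g)) (topspace X))"
proof (rule G_space_restrictI[OF T])
  interpret a: group_action G "topspace E" \<phi>
    using E by (simp add: G_space_def)
  have TG: "topspace T = carrier G"
    using T by (simp add: topological_group_def)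
  have topX: "topspace X = {0..1} \<times> U"
    using U by (auto simp: X_def)
  have UE: "fst u \<in> topspace E" "snd u \<in> topspace E" if "u \<in> U" for u
    using U that by (auto simp: fibre_product_def)
  show "Hausdorff_space X"
    using E by (simp add: X_def fibre_product_def G_space_def Hausdorff_space_prod_topology
        Hausdorff_space_subtopology)
  show "map_prod id (diagonal_action \<phi> g) x \<in> topspace X"
    if "g \<in> carrier G" "x \<in> topspace X" for g x
    using that inv by (auto simp: topX)
  show "map_prod id (diagonal_action \<phi> \<one>\<^bsub>G\<^esub>) x = x" if "x \<in> topspace X" for x
    using that UE by (cases x) (auto simp: topX diagonal_action_def a.id_eq_one[symmetric])
  show "map_prod id (diagonal_action \<phi> (g \<otimes>\<^bsub>G\<^esub> h)) x =
      map_prod id (diagonal_action \<phi> g) (map_prod id (diagonal_action \<phi> h) x)"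
    if "g \<in> carrier G" "h \<in> carrier G" "x \<in> topspace X" for g h x
    using that UE by (cases x) (force simp: topX diagonal_action_def a.composition_rule)
  let ?P = "prod_topology T X"
  have act: "continuous_map ?P E (\<lambda>z. \<phi> (fst z) (k (snd (snd z))))"
    if k: "continuous_map (subtopology (fibre_product E p) U) E k" for k
  proof -
    have "continuous_map ?P (subtopology (fibre_product E p) U) (snd \<circ> snd)"
      unfolding X_def by (rule continuous_map_compose[OF continuous_map_snd continuous_map_snd])
    from continuous_map_compose[OF this k]
    have "continuous_map ?P (prod_topology T E) (\<lambda>z. (fst z, k (snd (snd z))))"
      by (intro continuous_map_pairedI continuous_map_fst) (simp add: o_def)
    from continuous_map_compose[OF this, of E "\<lambda>(g, x). \<phi> g x"] E show ?thesis
      by (simp add: o_def G_space_def)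
  qed
  have "continuous_map (subtopology (fibre_product E p) U) (fibre_product E p) (\<lambda>u. u)"
    by (simp add: continuous_map_from_subtopology)
  then have "continuous_map ?P E (\<lambda>z. \<phi> (fst z) (fst (snd (snd z))))"
    "continuous_map ?P E (\<lambda>z. \<phi> (fst z) (snd (snd (snd z))))"
    using act by (auto simp: continuous_map_fibre_product_iff)
  moreover have "diagonal_action \<phi> (fst z) (snd (snd z)) \<in> U" if "z \<in> topspace ?P" for z
    using that inv TG by (auto simp: topX)
  moreover have "p (fst u) = p (snd u)" if "u \<in> U" for u
    using U that by (auto simp: fibre_product_def)
  ultimately have "continuous_map ?P (subtopology (fibre_product E p) U)
      (\<lambda>z. diagonal_action \<phi> (fst z) (snd (snd z)))"
    by (simp add: continuous_map_in_subtopology continuous_map_fibre_product_iff image_subset_iff)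
       (simp add: diagonal_action_def)
  moreover have "continuous_map ?P unit_interval (fst \<circ> snd)"
    unfolding X_def by (rule continuous_map_compose[OF continuous_map_snd continuous_map_fst])
  ultimately show "continuous_map ?P X (\<lambda>(g, x). map_prod id (diagonal_action \<phi> g) x)"
    unfolding X_def by (simp add: continuous_map_pairwise o_def case_prod_unfold map_prod_def)
qed

section \<open>Sections as motions inside the fibres\<close>

definition fibrewise_motion ::
  "('g, 'm) monoid_scheme \<Rightarrow> 'e topology \<Rightarrow> ('g \<Rightarrow> 'e \<Rightarrow> 'e) \<Rightarrow> ('e \<Rightarrow> 'b) \<Rightarrow> ('e \<times> 'e) set \<Rightarrow>
   (real \<times> 'e \<times> 'e \<Rightarrow> 'e) \<Rightarrow> bool" where
  "fibrewise_motion G E \<phi> p U F \<longleftrightarrow>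
     G_map G (prod_topology unit_interval (subtopology (fibre_product E p) U))
       (\<lambda>g. map_prod id (diagonal_action \<phi> g)) E \<phi> F \<and>
     (\<forall>u\<in>U. F (0, u) = fst u \<and> F (1, u) = snd u \<and> (\<forall>t\<in>{0..1}. p (F (t, u)) = p (fst u)))"

text \<open>Uncurrying a section is continuous because evaluation of paths is, the interval being
  locally compact; for currying the compact-open topology suffices. The base point that
  \<open>fibre_path_space\<close> asks for is \<open>p (fst u)\<close>.\<close>

lemma section_iff_fibrewise_motion:
  assumes p: "continuous_map E B p"
    and U: "U \<subseteq> topspace (fibre_product E p)"
    and inv: "\<forall>g\<in>carrier G. \<forall>u\<in>U. diagonal_action \<phi> g u \<in> U"
  shows "(\<exists>\<sigma>. G_map G (subtopology (fibre_product E p) U) (diagonal_action \<phi>)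
             (fibre_path_space E B p) (path_action \<phi>) \<sigma> \<and> (\<forall>u\<in>U. path_ends (\<sigma> u) = u))
     \<longleftrightarrow> (\<exists>F. fibrewise_motion G E \<phi> p U F)" (is "?sec \<longleftrightarrow> ?motion")
proof
  let ?S = "subtopology (fibre_product E p) U"
  have topU: "topspace ?S = U" "topspace (fibre_product E p) \<inter> U = U"
    using U by auto
  show ?motion if ?sec
  proof -
    from that obtain \<sigma> where cont: "continuous_map ?S (fibre_path_space E B p) \<sigma>"
      and equi: "\<And>g u. g \<in> carrier G \<Longrightarrow> u \<in> U \<Longrightarrow> \<sigma> (diagonal_action \<phi> g u) = path_action \<phi> g (\<sigma> u)"
      and ends: "\<And>u. u \<in> U \<Longrightarrow> path_ends (\<sigma> u) = u"
      by (auto simp: G_map_def equivariant_on_def topU)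
    have path: "continuous_map ?S (path_space E) \<sigma>"
      and fibre: "\<And>u. u \<in> U \<Longrightarrow> \<exists>b\<in>topspace B. \<forall>t\<in>{0..1}. p (\<sigma> u t) = b"
      using cont by (auto simp: fibre_path_space_def continuous_map_in_subtopology topU
          image_subset_iff)
    let ?P = "prod_topology unit_interval ?S"
    have "continuous_map ?P (path_space E) (\<sigma> \<circ> snd)"
      by (rule continuous_map_compose[OF continuous_map_snd path])
    then have "continuous_map ?P (prod_topology (path_space E) unit_interval)
        (\<lambda>z. (\<sigma> (snd z), fst z))"
      by (intro continuous_map_pairedI continuous_map_fst) (simp add: o_def)
    from continuous_map_compose[OF this continuous_map_path_space_eval]
    have "continuous_map ?P E (\<lambda>(t, u). \<sigma> u t)"
      by (simp add: o_def case_prod_unfold)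
    moreover have "\<sigma> u 0 = fst u" "\<sigma> u 1 = snd u" if "u \<in> U" for u
      using ends[OF that] by (auto simp: path_ends_def prod_eq_iff)
    moreover have "p (\<sigma> u t) = p (\<sigma> u 0)" if "u \<in> U" "t \<in> {0..1}" for u t
      using fibre[OF that(1)] that(2) by auto
    ultimately have "fibrewise_motion G E \<phi> p U (\<lambda>(t, u). \<sigma> u t)"
      by (auto simp: fibrewise_motion_def G_map_def equivariant_on_def topU equi path_action_def)
    then show ?thesis
      by blast
  qed
  show ?sec if ?motion
  proof -
    from that obtain F where cont: "continuous_map (prod_topology unit_interval ?S) E F"
      and equi: "\<And>g t u. g \<in> carrier G \<Longrightarrow> t \<in> {0..1} \<Longrightarrow> u \<in> U \<Longrightarrow>
        F (t, diagonal_action \<phi> g u) = \<phi> g (F (t, u))"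
      and F: "\<And>u. u \<in> U \<Longrightarrow> F (0, u) = fst u" "\<And>u. u \<in> U \<Longrightarrow> F (1, u) = snd u"
      and fibre: "\<And>t u. u \<in> U \<Longrightarrow> t \<in> {0..1} \<Longrightarrow> p (F (t, u)) = p (fst u)"
      by (auto simp: fibrewise_motion_def G_map_def equivariant_on_def topU)
    let ?\<sigma> = "\<lambda>u. \<lambda>t\<in>{0..1}. F (t, u)"
    have "continuous_map ?S (path_space E) ?\<sigma>"
      using continuous_map_compact_open_curry[OF cont] by simp
    moreover have "p (fst u) \<in> topspace B" if "u \<in> U" for u
      using that U continuous_map_funspace[OF p] by (auto simp: fibre_product_def Pi_iff)
    ultimately have "continuous_map ?S (fibre_path_space E B p) ?\<sigma>"
      using fibre by (fastforce simp: fibre_path_space_def continuous_map_in_subtopology topU)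
    then have "G_map G ?S (diagonal_action \<phi>) (fibre_path_space E B p) (path_action \<phi>) ?\<sigma>"
      using inv by (auto simp: G_map_def equivariant_on_def topU path_action_def equi fun_eq_iff)
    then show ?thesis
      using F by (intro exI[of _ ?\<sigma>]) (auto simp: path_ends_def)
  qed
qed

section \<open>Motions and deformations into the diagonal\<close>

lemma continuous_map_reparametrize:
  assumes "continuous_map (prod_topology unit_interval S) Y h"
    and "continuous_map X unit_interval k" and "continuous_map X S j"
  shows "continuous_map X Y (\<lambda>x. h (k x, j x))"
  using continuous_map_compose[OF continuous_map_pairedI[OF assms(2,3)] assms(1)]
  by (simp add: o_def)

lemma diagonal_deformation_of_fibrewise_motion:
  assumes U: "U \<subseteq> topspace (fibre_product E p)"
    and inv: "\<forall>g\<in>carrier G. \<forall>u\<in>U. diagonal_action \<phi> g u \<in> U"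
    and F: "fibrewise_motion G E \<phi> p U F"
  defines "f \<equiv> \<lambda>u. (fst u, fst u)"
  shows "G_map G (subtopology (fibre_product E p) U) (diagonal_action \<phi>)
           (fibre_product E p) (diagonal_action \<phi>) f"
    and "f ` U \<subseteq> {(e, e) |e. e \<in> topspace E}"
    and "G_homotopic G (subtopology (fibre_product E p) U) (diagonal_action \<phi>)
           (fibre_product E p) (diagonal_action \<phi>) (\<lambda>u. u) f"
proof -
  let ?S = "subtopology (fibre_product E p) U"
  let ?P = "prod_topology unit_interval ?S"
  have topU: "topspace ?S = U" "topspace (fibre_product E p) \<inter> U = U"
    using U by auto
  have incl: "continuous_map ?S (fibre_product E p) (\<lambda>u. u)"
    by (simp add: continuous_map_from_subtopology)
  have cont: "continuous_map ?P E F"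
    and equi: "\<And>g t u. g \<in> carrier G \<Longrightarrow> t \<in> {0..1} \<Longrightarrow> u \<in> U \<Longrightarrow>
        F (t, diagonal_action \<phi> g u) = \<phi> g (F (t, u))"
    and F: "\<And>u. u \<in> U \<Longrightarrow> F (0, u) = fst u" "\<And>u. u \<in> U \<Longrightarrow> F (1, u) = snd u"
    and fibre: "\<And>t u. u \<in> U \<Longrightarrow> t \<in> {0..1} \<Longrightarrow> p (F (t, u)) = p (fst u)"
    using F by (auto simp: fibrewise_motion_def G_map_def equivariant_on_def topU)
  show "G_map G ?S (diagonal_action \<phi>) (fibre_product E p) (diagonal_action \<phi>) f"
    using incl by (auto simp: f_def G_map_def equivariant_on_def diagonal_action_def
        continuous_map_fibre_product_iff)
  show "f ` U \<subseteq> {(e, e) |e. e \<in> topspace E}"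
    using U by (auto simp: f_def fibre_product_def)
  define h where "h = (\<lambda>(t, u). (fst u, F (1 - t, u)))"
  have "continuous_map ?P E (\<lambda>z. F (1 - fst z, snd z))"
  proof (rule continuous_map_reparametrize[OF cont _ continuous_map_snd])
    have "continuous_map unit_interval unit_interval (\<lambda>t. 1 - t)"
      by (auto intro!: continuous_intros)
    from continuous_map_compose[OF continuous_map_fst this]
    show "continuous_map ?P unit_interval (\<lambda>z. 1 - fst z)"
      by (simp add: o_def)
  qed
  moreover have "continuous_map ?P E (\<lambda>z. fst (snd z))"
    using continuous_map_compose[OF continuous_map_snd, of ?S E fst unit_interval] incl
    by (simp add: continuous_map_fibre_product_iff o_def)
  ultimately have h: "continuous_map ?P (fibre_product E p) h"
    using fibre by (auto simp: continuous_map_fibre_product_iff h_def case_prod_unfold topU)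
  have cong: "equivariant_on G U (diagonal_action \<phi>) (diagonal_action \<phi>) k \<longleftrightarrow>
      equivariant_on G U (diagonal_action \<phi>) (diagonal_action \<phi>) l"
    if "\<And>u. u \<in> U \<Longrightarrow> k u = l u" for k l
    using that inv by (simp add: equivariant_on_def)
  show "G_homotopic G ?S (diagonal_action \<phi>) (fibre_product E p) (diagonal_action \<phi>) (\<lambda>u. u) f"
    unfolding G_homotopic_def topU
    \<comment> \<open>\<open>homotopic_with\<close> prescribes both ends of a homotopy even off the space; there \<open>h\<close> is arbitrary,
      which is harmless as equivariance on \<open>U\<close> depends only on the values on \<open>U\<close>.\<close>
  proof (subst homotopic_with)
    show "\<exists>h. continuous_map ?P (fibre_product E p) h \<and>
        (\<forall>u\<in>topspace ?S. h (0, u) = u) \<and> (\<forall>u\<in>topspace ?S. h (1, u) = f u) \<and>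
        (\<forall>t\<in>{0..1}. equivariant_on G U (diagonal_action \<phi>) (diagonal_action \<phi>) (\<lambda>u. h (t, u)))"
      using h F equi
      by (intro exI[of _ h])
         (auto simp: h_def topU f_def equivariant_on_def diagonal_action_def)
  qed (rule cong, simp add: topU)
qed

text \<open>In the square with coordinates \<open>(s, r)\<close> the side \<open>s = 0\<close> carries the given path from
  \<open>fst u\<close> to \<open>snd u\<close>, and the path \<open>t \<mapsto> (c t, d t)\<close> in the proof runs through the other three sides,
  spending one third of the time on each. The height \<open>(1 - s) * (1 - \<bar>2 * r - 1\<bar>)\<close> of the point
  reached on the path in the base vanishes exactly on these three sides.\<close>

lemma fibrewise_motion_of_diagonal_deformation:
  assumes T: "topological_group G T" and fib: "G_fibration G T E \<phi> B \<psi> p"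
    and U: "U \<subseteq> topspace (fibre_product E p)"
    and inv: "\<forall>g\<in>carrier G. \<forall>u\<in>U. diagonal_action \<phi> g u \<in> U"
    and diag: "f ` U \<subseteq> {(e, e) |e. e \<in> topspace E}"
    and hom: "G_homotopic G (subtopology (fibre_product E p) U) (diagonal_action \<phi>)
                (fibre_product E p) (diagonal_action \<phi>) (\<lambda>u. u) f"
  shows "\<exists>F. fibrewise_motion G E \<phi> p U F"
proof -
  let ?S = "subtopology (fibre_product E p) U"
  let ?X = "prod_topology unit_interval ?S"
  let ?\<theta> = "\<lambda>g. restrict (map_prod id (diagonal_action \<phi> g)) (topspace ?X)"
  have topU: "topspace ?S = U" "topspace (fibre_product E p) \<inter> U = U"
    using U by auto
  have topX: "topspace ?X = {0..1} \<times> U"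
    by (simp add: topU)
  have p: "continuous_map E B p"
    and p_equi: "\<And>g e. g \<in> carrier G \<Longrightarrow> e \<in> topspace E \<Longrightarrow> p (\<phi> g e) = \<psi> g (p e)"
    using fib by (auto simp: G_fibration_def G_map_def equivariant_on_def)
  obtain H where H: "continuous_map ?X (fibre_product E p) H"
    and H0: "\<And>u. H (0, u) = u" and H1: "\<And>u. H (1, u) = f u"
    and H_equi: "\<And>t. t \<in> {0..1} \<Longrightarrow>
      equivariant_on G U (diagonal_action \<phi>) (diagonal_action \<phi>) (\<lambda>u. H (t, u))"
    using hom unfolding G_homotopic_def homotopic_with_def topU by auto
  define a where "a = (\<lambda>z. fst (H z))"
  define b where "b = (\<lambda>z. snd (H z))"
  have a: "continuous_map ?X E a" and b: "continuous_map ?X E b"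
    and pab: "\<And>t u. t \<in> {0..1} \<Longrightarrow> u \<in> U \<Longrightarrow> p (a (t, u)) = p (b (t, u))"
    using H unfolding continuous_map_fibre_product_iff a_def b_def topX by auto
  have aE: "a (t, u) \<in> topspace E" if "t \<in> {0..1}" "u \<in> U" for t u
    using a that unfolding continuous_map_def topX by auto
  have ab_equi: "a (t, diagonal_action \<phi> g u) = \<phi> g (a (t, u))"
    "b (t, diagonal_action \<phi> g u) = \<phi> g (b (t, u))"
    if "t \<in> {0..1}" "g \<in> carrier G" "u \<in> U" for t g u
    using H_equi[OF that(1)] that by (auto simp: a_def b_def equivariant_on_def diagonal_action_def)
  have meet: "a (1, u) = b (1, u)" if "u \<in> U" for u
    using diag that by (auto simp: a_def b_def H1)
  have reparam: "continuous_map Y unit_interval (\<lambda>z. k (j z))"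
    if "continuous_map Y euclidean j" "continuous_on UNIV k"
      "\<And>z. z \<in> topspace Y \<Longrightarrow> k (j z) \<in> {0..1}" for Y and j :: "'y \<Rightarrow> 'r::topological_space" and k
  proof -
    have "continuous_map Y euclidean (k \<circ> j)"
      using that by (intro continuous_map_compose[where X' = euclidean]) auto
    then show ?thesis
      using that(3) by (auto simp: continuous_map_in_subtopology o_def)
  qed

  \<comment> \<open>The two halves of \<open>\<alpha>\<close> fit together at \<open>r = 1/2\<close> because \<open>H\<close> ends in the diagonal.\<close>
  define \<alpha> where "\<alpha> = (\<lambda>(r, u). if r \<le> 1/2 then a (2 * r, u) else b (2 - 2 * r, u))"
  have fstX: "continuous_map ?X euclideanreal fst"
    using continuous_map_fst[of unit_interval ?S] continuous_map_into_fulltopology by blast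
  have "continuous_map ?X E \<alpha>"
    unfolding \<alpha>_def case_prod_unfold
  proof (rule continuous_map_cases_le)
    show "continuous_map ?X euclideanreal fst" "continuous_map ?X euclideanreal (\<lambda>z. 1/2)"
      using fstX by auto
    show "continuous_map (subtopology ?X {z \<in> topspace ?X. fst z \<le> 1/2}) E (\<lambda>z. a (2 * fst z, snd z))"
      by (intro continuous_map_reparametrize[OF a] reparam continuous_map_from_subtopology fstX
          continuous_map_snd continuous_intros) (auto simp: topX)
    show "continuous_map (subtopology ?X {z \<in> topspace ?X. 1/2 \<le> fst z}) E
        (\<lambda>z. b (2 - 2 * fst z, snd z))"
      by (intro continuous_map_reparametrize[OF b] reparam continuous_map_from_subtopology fstX
          continuous_map_snd continuous_intros) (auto simp: topX)
    show "a (2 * fst z, snd z) = b (2 - 2 * fst z, snd z)"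
      if "z \<in> topspace ?X" "fst z = 1/2" for z
    proof -
      have "2 * fst z = 1" "2 - 2 * fst z = 1" "snd z \<in> U"
        using that by (auto simp: topU)
      then show ?thesis
        using meet by (simp only:)
    qed
  qed
  then have \<alpha>: "G_map G ?X ?\<theta> E \<phi> \<alpha>"
    by (auto simp: G_map_def equivariant_on_def topX \<alpha>_def ab_equi)

  define \<eta> where "\<eta> = (\<lambda>s r::real. (1 - s) * (1 - \<bar>2 * r - 1\<bar>))"
  have \<eta>01: "\<eta> s r \<in> {0..1}" if "s \<in> {0..1}" "r \<in> {0..1}" for s r
    using that by (auto simp: \<eta>_def mult_le_one)
  \<comment> \<open>The first coordinate \<open>a\<close> alone defines the contraction in the base, as \<open>p \<circ> a = p \<circ> b\<close>.\<close>
  define D where "D = (\<lambda>(s, r, u). p (a (\<eta> s r, u)))"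
  let ?Y = "prod_topology unit_interval ?X"
  have "continuous_map ?Y E (\<lambda>z. a (\<eta> (fst z) (fst (snd z)), snd (snd z)))"
  proof (rule continuous_map_reparametrize[OF a])
    have "continuous_map ?Y euclideanreal fst"
      using continuous_map_fst[of unit_interval ?X] continuous_map_into_fulltopology by blast
    moreover have "continuous_map ?Y euclideanreal (\<lambda>z. fst (snd z))"
      using continuous_map_compose[OF continuous_map_snd fstX] by (simp add: o_def)
    ultimately have "continuous_map ?Y euclidean (\<lambda>z. (fst z, fst (snd z)))"
      by (simp add: continuous_map_pairedI flip: prod_topology_euclidean)
    moreover have "continuous_on UNIV (\<lambda>(s, r). \<eta> s r)"
      unfolding \<eta>_def case_prod_unfold by (intro continuous_intros)
    ultimately show "continuous_map ?Y unit_interval (\<lambda>z. \<eta> (fst z) (fst (snd z)))"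
      using reparam[of ?Y "\<lambda>z. (fst z, fst (snd z))" "\<lambda>(s, r). \<eta> s r"] \<eta>01 by (auto simp: topX)
    show "continuous_map ?Y ?S (\<lambda>z. snd (snd z))"
      using continuous_map_compose[OF continuous_map_snd continuous_map_snd] by (simp add: o_def)
  qed
  from continuous_map_compose[OF this p] have "continuous_map ?Y B D"
    by (simp add: D_def o_def case_prod_unfold)
  then have D: "G_map G ?Y (\<lambda>g. map_prod id (?\<theta> g)) B \<psi> D"
    using \<eta>01 aE by (auto simp: G_map_def equivariant_on_def topX D_def ab_equi p_equi)
  have D0: "\<forall>x\<in>topspace ?X. D (0, x) = p (\<alpha> x)"
  proof
    fix x assume "x \<in> topspace ?X"
    then obtain r u where x: "x = (r, u)" "r \<in> {0..1}" "u \<in> U"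
      unfolding topX by blast
    have "\<eta> 0 r = (if r \<le> 1/2 then 2 * r else 2 - 2 * r)"
      by (auto simp: \<eta>_def)
    then show "D (0, x) = p (\<alpha> x)"
      using x pab by (auto simp: D_def \<alpha>_def)
  qed
  have "G_homotopy_lifting G E \<phi> B \<psi> p ?X ?\<theta>"
    using fib by (intro G_fibration_lifting[OF fib T]
        G_space_interval_times_invariant_set[OF T _ U inv]) (simp add: G_fibration_def)
  from this[unfolded G_homotopy_lifting_def, rule_format, OF conjI[OF \<alpha> conjI[OF D D0]]]
  obtain K where K: "G_map G ?Y (\<lambda>g. map_prod id (?\<theta> g)) E \<phi> K"
    and K0: "\<And>x. x \<in> topspace ?X \<Longrightarrow> K (0, x) = \<alpha> x"
    and pK: "\<And>t x. t \<in> {0..1} \<Longrightarrow> x \<in> topspace ?X \<Longrightarrow> p (K (t, x)) = D (t, x)"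
    by auto

  define c :: "real \<Rightarrow> real" where "c = (\<lambda>t. min 1 (min (3 * t) (3 - 3 * t)))"
  define d :: "real \<Rightarrow> real" where "d = (\<lambda>t. max 0 (min 1 (3 * t - 1)))"
  have cd: "c t \<in> {0..1}" "d t \<in> {0..1}" "\<eta> (c t) (d t) = 0" if "t \<in> {0..1}" for t
    using that by (auto simp: c_def d_def \<eta>_def min_def max_def)
  define F where "F = (\<lambda>(t, u). K (c t, d t, u))"
  have "continuous_map ?X E F"
    unfolding F_def case_prod_unfold
  proof (rule continuous_map_reparametrize)
    show "continuous_map ?Y E K"
      using K by (simp add: G_map_def)
    have "continuous_map ?X unit_interval (\<lambda>z. d (fst z))"
      using cd(2) by (intro reparam fstX) (auto simp: d_def topX intro!: continuous_intros)
    then show "continuous_map ?X ?X (\<lambda>z. (d (fst z), snd z))"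
      by (intro continuous_map_pairedI continuous_map_snd)
    show "continuous_map ?X unit_interval (\<lambda>z. c (fst z))"
      using cd(1) by (intro reparam fstX) (auto simp: c_def topX intro!: continuous_intros)
  qed
  moreover have "F (t, diagonal_action \<phi> g u) = \<phi> g (F (t, u))"
    if "t \<in> {0..1}" "g \<in> carrier G" "u \<in> U" for t g u
    using K that cd(1,2)[of t] by (simp add: F_def G_map_def equivariant_on_def topU)
  moreover have "p (F (t, u)) = p (fst u)" if "t \<in> {0..1}" "u \<in> U" for t u
    using that cd[of t] pK by (simp add: F_def topU D_def a_def H0)
  moreover have "F (0, u) = fst u" "F (1, u) = snd u" if "u \<in> U" for u
    using that K0 by (simp_all add: F_def c_def d_def topU \<alpha>_def a_def b_def H0)
  ultimately have "fibrewise_motion G E \<phi> p U F"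
    by (auto simp: fibrewise_motion_def G_map_def equivariant_on_def topU)
  then show ?thesis
    by blast
qed

theorem theorem3p2:
  fixes G :: "('g, 'm) monoid_scheme" and T :: "'g topology"
    and E :: "'e topology" and \<phi> :: "'g \<Rightarrow> 'e \<Rightarrow> 'e"
    and B :: "'b topology" and \<psi> :: "'g \<Rightarrow> 'b \<Rightarrow> 'b"
    and p :: "'e \<Rightarrow> 'b" and U :: "('e \<times> 'e) set"
  assumes "topological_group G T"
    and "G_fibration G T E \<phi> B \<psi> p"
    and "U \<subseteq> topspace (fibre_product E p)"
    and "\<forall>g\<in>carrier G. \<forall>u\<in>U. diagonal_action \<phi> g u \<in> U"
  shows "(\<exists>\<sigma>. G_map G (subtopology (fibre_product E p) U) (diagonal_action \<phi>)
                (fibre_path_space E B p) (path_action \<phi>) \<sigma> \<and>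
              (\<forall>u\<in>U. path_ends (\<sigma> u) = u))
     \<longleftrightarrow>
         (\<exists>f. G_map G (subtopology (fibre_product E p) U) (diagonal_action \<phi>)
                (fibre_product E p) (diagonal_action \<phi>) f \<and>
              f ` U \<subseteq> {(e, e) |e. e \<in> topspace E} \<and>
              G_homotopic G (subtopology (fibre_product E p) U) (diagonal_action \<phi>)
                (fibre_product E p) (diagonal_action \<phi>) (\<lambda>u. u) f)"
proof -
  have p: "continuous_map E B p"
    using assms(2) by (simp add: G_fibration_def G_map_def)
  show ?thesis
    unfolding section_iff_fibrewise_motion[OF p assms(3,4)]
    using diagonal_deformation_of_fibrewise_motion[OF assms(3,4)]
      fibrewise_motion_of_diagonal_deformation[OF assms]
    by blast
qed

end
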